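(* Let $\sigma_0, \sigma, L > 0$ be real numbers, let $D \subset \mathbb{R}$ be a convex set (an interval), and let $y_1, y_2 \in D$ with $y_1 < y_2$. Consider the problem of maximizing over $x \in D$ the function $$f(x) = \frac{\sigma_0^4}{\sigma_0^2+\sigma^2}\left(e^{-\frac{1}{L^2}\lVert x-y_1\rVert^2} + e^{-\frac{1}{L^2}\lVert x-y_2\rVert^2}\right),$$ and let $x^* = \frac{y_1+y_2}{2}$ be the midpoint. Then the optimal solution of this problem is $x^*$ (that is, $x^*$ is a global maximizer of $f$ over $D$) if and only if $\lVert y_2 - y_1 \rVert \le \sqrt{2}\, L$.
   Context: Here $\lVert \cdot \rVert$ is the absolute value on $\mathbb{R}$. The function $f(x)$ is the total variance reduction at the two prediction locations $\Omega=\{y_1,y_2\}$ obtained from a single noisy measurement (budget $k=1$) at location $x$ in the set of measurement locations $\Theta = D$. The underlying field has zero mean and squared exponential covariance $\phi_{\mathrm{SE}}(r) = \sigma_0^2 e^{-r^2/(2L^2)}$, and the measurement noise has variance $\sigma^2$. *)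

theory Defs
  imports "HOL-Analysis.Analysis"
begin

text \<open>
  Total variance reduction at the prediction locations \<open>y1\<close>, \<open>y2\<close> due to one noisy measurement
  at \<open>x\<close>.  The field has covariance \<open>\<phi>(r) = \<sigma>0\<^sup>2 exp (- r\<^sup>2 / (2 L\<^sup>2))\<close> and the noise has variance
  \<open>\<sigma>\<^sup>2\<close>, so each \<open>yi\<close> contributes \<open>\<phi>(\<bar>x - yi\<bar>)\<^sup>2 / (\<phi>(0) + \<sigma>\<^sup>2)\<close>; squaring \<open>\<phi>\<close> cancels the 2 in
  its exponent.
\<close>
definition variance_reduction ::
    "real \<Rightarrow> real \<Rightarrow> real \<Rightarrow> real \<Rightarrow> real \<Rightarrow> real \<Rightarrow> real" where
  "variance_reduction \<sigma>0 \<sigma> L y1 y2 x =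
     \<sigma>0 ^ 4 / (\<sigma>0\<^sup>2 + \<sigma>\<^sup>2) *
       (exp (- (1 / L\<^sup>2) * (norm (x - y1))\<^sup>2) + exp (- (1 / L\<^sup>2) * (norm (x - y2))\<^sup>2))"

end

theory Submission
  imports Defs
begin

text \<open>
  Write \<open>a = (y2 - y1) / 2\<close> and \<open>t = x - (y1 + y2) / 2\<close>. Factoring out \<open>exp (- (t\<^sup>2 + a\<^sup>2) / L\<^sup>2)\<close>
  leaves \<open>2 * cosh (2 * a * t / L\<^sup>2)\<close>, so the midpoint is optimal iff
  \<open>cosh (2 * a * t / L\<^sup>2) \<le> exp (t\<^sup>2 / L\<^sup>2)\<close> for all admissible \<open>t\<close>. If \<open>2 * a\<^sup>2 \<le> L\<^sup>2\<close> this follows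
  from \<open>cosh u \<le> exp (u\<^sup>2 / 2)\<close>; if \<open>2 * a\<^sup>2 > L\<^sup>2\<close> it fails for small \<open>t > 0\<close>, by comparing the
  second-order terms.
\<close>

lemma cosh_even_sums:
  fixes x :: real
  shows "(\<lambda>n. x ^ (2 * n) / fact (2 * n)) sums cosh x"
proof -
  \<comment> \<open>The odd terms of the \<open>cosh\<close> series vanish, so reindexing along the
    even numbers keeps the sum.\<close>
  have "((\<lambda>n. if even n then x ^ n /\<^sub>R fact n else 0) \<circ> (\<lambda>n. 2 * n)) sums cosh x"
    unfolding o_def using cosh_converges[of x]
    by (subst sums_mono_reindex) (auto simp: strict_mono_def elim!: evenE)
  then show ?thesis
    by (simp add: o_def divide_inverse mult.commute)
qed

text \<open>Serves the termwise comparison of the series of \<open>cosh u\<close> and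
  \<open>exp (u\<^sup>2 / 2)\<close>. From \<open>n\<close> to \<open>n + 1\<close> the left side
  gains the factor \<open>2 * n + 2\<close>, the right side
  \<open>(2 * n + 2) * (2 * n + 1)\<close>.\<close>

lemma power2_mult_fact_le_fact_double: "2 ^ n * fact n \<le> (fact (2 * n) :: real)"
proof (induction n)
  case (Suc n)
  have "2 ^ Suc n * fact (Suc n) = (2 * real n + 2) * (2 ^ n * fact n)"
    by (simp add: algebra_simps)
  also have "\<dots> \<le> (2 * real n + 2) * ((2 * real n + 1) * fact (2 * n))"
    using Suc by (intro mult_left_mono order.trans[OF Suc]) (auto simp: algebra_simps)
  also have "\<dots> = fact (2 * Suc n)"
    by (simp add: algebra_simps)
  finally show ?case .
qed simp

lemma cosh_le_exp_half_square:
  fixes u :: real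
  shows "cosh u \<le> exp (u\<^sup>2 / 2)"
proof (rule sums_le)
  show "(\<lambda>n. u ^ (2 * n) / fact (2 * n)) sums cosh u"
    by (rule cosh_even_sums)
  show "(\<lambda>n. (u\<^sup>2 / 2) ^ n /\<^sub>R fact n) sums exp (u\<^sup>2 / 2)"
    by (rule exp_converges)
  fix n
  have "u ^ (2 * n) / fact (2 * n) \<le> u ^ (2 * n) / (2 ^ n * fact n)"
    by (intro divide_left_mono power2_mult_fact_le_fact_double) auto
  also have "\<dots> = (u\<^sup>2 / 2) ^ n /\<^sub>R fact n"
    unfolding power_mult power_divide real_scaleR_def by (simp add: field_simps)
  finally show "u ^ (2 * n) / fact (2 * n) \<le> (u\<^sup>2 / 2) ^ n /\<^sub>R fact n" .
qed

text \<open>The even power series has nonnegative terms, so its first two bound the sum from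
  below.\<close>

lemma cosh_ge_one_plus_half_square:
  fixes u :: real
  shows "1 + u\<^sup>2 / 2 \<le> cosh u"
proof -
  have "(\<Sum>n<2. u ^ (2 * n) / fact (2 * n)) \<le> (\<Sum>n. u ^ (2 * n) / fact (2 * n))"
    by (rule sum_le_suminf) (auto intro: sums_summable[OF cosh_even_sums])
  then show ?thesis
    using sums_unique[OF cosh_even_sums[of u]] by (simp add: numeral_2_eq_2)
qed

lemma variance_reduction_midpoint_shift:
  assumes "a = (y2 - y1) / 2"
  shows "variance_reduction \<sigma>0 \<sigma> L y1 y2 ((y1 + y2) / 2 + t)
       = \<sigma>0 ^ 4 / (\<sigma>0\<^sup>2 + \<sigma>\<^sup>2) * (2 * exp (- (a\<^sup>2 / L\<^sup>2)) *
           (cosh (2 * a * t / L\<^sup>2) * exp (- (t\<^sup>2 / L\<^sup>2))))"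
proof -
  have shift: "(y1 + y2) / 2 + t - y1 = t + a" "(y1 + y2) / 2 + t - y2 = t - a"
    using assms by (auto simp: field_simps)
  have expand:
    "- (1 / L\<^sup>2) * (t + a)\<^sup>2 = - (a\<^sup>2 / L\<^sup>2) + (- (2 * a * t / L\<^sup>2) + - (t\<^sup>2 / L\<^sup>2))"
    "- (1 / L\<^sup>2) * (t - a)\<^sup>2 = - (a\<^sup>2 / L\<^sup>2) + (2 * a * t / L\<^sup>2 + - (t\<^sup>2 / L\<^sup>2))"
    by (simp_all add: power2_sum power2_diff divide_inverse algebra_simps)
  show ?thesis
    unfolding variance_reduction_def shift real_norm_def power2_abs expand exp_add cosh_field_def
    by (simp add: algebra_simps)
qed

lemma variance_reduction_le_midpoint_iff:
  assumes "\<sigma>0 > 0" and "a = (y2 - y1) / 2"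
  shows "variance_reduction \<sigma>0 \<sigma> L y1 y2 ((y1 + y2) / 2 + t)
           \<le> variance_reduction \<sigma>0 \<sigma> L y1 y2 ((y1 + y2) / 2)
         \<longleftrightarrow> cosh (2 * a * t / L\<^sup>2) \<le> exp (t\<^sup>2 / L\<^sup>2)"
proof -
  \<comment> \<open>\<open>K\<close> is the positive factor independent of the shift. At shift 0 the
    remaining factor is 1, so \<open>K\<close> is also the value at the midpoint and cancels from
    the comparison.\<close>
  define K where "K = \<sigma>0 ^ 4 / (\<sigma>0\<^sup>2 + \<sigma>\<^sup>2) * (2 * exp (- (a\<^sup>2 / L\<^sup>2)))"
  have "K > 0"
    using assms(1) by (auto simp: K_def intro!: divide_pos_pos add_pos_nonneg)
  have val: "variance_reduction \<sigma>0 \<sigma> L y1 y2 ((y1 + y2) / 2 + s)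
      = K * (cosh (2 * a * s / L\<^sup>2) * exp (- (s\<^sup>2 / L\<^sup>2)))" for s
    unfolding variance_reduction_midpoint_shift[OF assms(2)] K_def by (simp only: mult.assoc)
  have "variance_reduction \<sigma>0 \<sigma> L y1 y2 ((y1 + y2) / 2) = K"
    using val[of 0] by simp
  then show ?thesis
    using \<open>K > 0\<close> unfolding val by (simp add: exp_minus field_simps)
qed

text \<open>The bound \<open>t \<le> a\<close> keeps the point at offset \<open>t\<close> from the
  midpoint inside the segment from \<open>y1\<close> to \<open>y2\<close>, hence inside
  \<open>D\<close>.\<close>

lemma exp_square_less_cosh:
  fixes a L :: real
  assumes "a > 0" and "L > 0" and "L\<^sup>2 < 2 * a\<^sup>2"
  obtains t where "0 < t" and "t \<le> a" and "exp (t\<^sup>2 / L\<^sup>2) < cosh (2 * a * t / L\<^sup>2)"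
proof -
  \<comment> \<open>With \<open>u = 2 * a * t / L\<^sup>2\<close>, \<open>c\<close> is the ratio of
    \<open>u\<^sup>2 / 2\<close> to \<open>t\<^sup>2 / L\<^sup>2\<close>, the second-order terms of
    the two sides.\<close>
  define c where "c = 2 * a\<^sup>2 / L\<^sup>2"
  have c: "c > 1"
    using assms by (simp add: c_def)
  \<comment> \<open>\<open>s = t\<^sup>2 / L\<^sup>2\<close> is chosen such that \<open>exp s \<le> 1 + s + s\<^sup>2 < 1 + c * s\<close> and \<open>t \<le> a\<close>.\<close>
  define s where "s = min 1 ((c - 1) / 2)"
  define t where "t = L * sqrt s"
  have s: "0 < s" "s \<le> 1" "s < c - 1" "s \<le> c / 2"
    using c by (simp_all add: s_def min_def)
  have t2: "t\<^sup>2 = L\<^sup>2 * s"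
    using s by (simp add: t_def power_mult_distrib)
  have "t\<^sup>2 \<le> L\<^sup>2 * (c / 2)"
    unfolding t2 using s by (intro mult_left_mono) auto
  also have "\<dots> = a\<^sup>2"
    using assms by (simp add: c_def)
  finally have "t \<le> a"
    using assms by (auto intro: power2_le_imp_le)
  moreover have "0 < t"
    using assms s by (simp add: t_def)
  moreover have "exp (t\<^sup>2 / L\<^sup>2) < cosh (2 * a * t / L\<^sup>2)"
  proof -
    have "exp (t\<^sup>2 / L\<^sup>2) = exp s"
      using assms by (simp add: t2)
    \<comment> \<open>\<open>exp_bound\<close> is valid on the unit interval, hence the cap 1 in
      \<open>s\<close>.\<close>
    also have "\<dots> \<le> 1 + s + s\<^sup>2"
      using s by (intro exp_bound) auto
    also have "\<dots> = 1 + s * (1 + s)"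
      by (simp add: power2_eq_square algebra_simps)
    also have "\<dots> < 1 + s * c"
      using s by (intro add_strict_left_mono mult_strict_left_mono) auto
    also have "s * c = (2 * a * t / L\<^sup>2)\<^sup>2 / 2"
      using assms by (simp add: c_def power_divide power_mult_distrib t2 field_simps)
    also have "1 + \<dots> \<le> cosh (2 * a * t / L\<^sup>2)"
      by (rule cosh_ge_one_plus_half_square)
    finally show ?thesis .
  qed
  ultimately show ?thesis
    using that by blast
qed

theorem proposition1:
  fixes \<sigma>0 \<sigma> L y1 y2 :: real and D :: "real set"
  assumes "\<sigma>0 > 0" and "\<sigma> > 0" and "L > 0"
    and "convex D" and "y1 \<in> D" and "y2 \<in> D" and "y1 < y2"
  shows "is_arg_max (variance_reduction \<sigma>0 \<sigma> L y1 y2) (\<lambda>x. x \<in> D) ((y1 + y2) / 2)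
         \<longleftrightarrow> norm (y2 - y1) \<le> sqrt 2 * L"
proof -
  define a where "a = (y2 - y1) / 2"
  define m where "m = (y1 + y2) / 2"
  have "a > 0" and norm_eq: "norm (y2 - y1) = 2 * a"
    using assms by (simp_all add: a_def)
  \<comment> \<open>Convexity enters here. The right half of the segment suffices: it contains the
    midpoint (\<open>t = 0\<close>) and the positive offset that refutes optimality.\<close>
  have mem: "m + t \<in> D" if "0 \<le> t" "t \<le> a" for t
  proof -
    have "closed_segment y1 y2 \<subseteq> D"
      using assms by (simp add: closed_segment_subset)
    moreover have "m + t \<in> {y1..y2}"
      using that \<open>a > 0\<close> by (simp add: m_def a_def field_simps)
    ultimately show ?thesis
      using assms by (auto simp: closed_segment_eq_real_ivl)
  qed
  have threshold: "2 * a \<le> sqrt 2 * L \<longleftrightarrow> 2 * a\<^sup>2 \<le> L\<^sup>2"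
  proof -
    have "2 * a \<le> sqrt 2 * L \<longleftrightarrow> (2 * a)\<^sup>2 \<le> (sqrt 2 * L)\<^sup>2"
      using \<open>a > 0\<close> assms by (intro power_mono_iff[symmetric]) auto
    then show ?thesis
      by (simp add: power_mult_distrib)
  qed
  have le_iff: "variance_reduction \<sigma>0 \<sigma> L y1 y2 (m + t) \<le> variance_reduction \<sigma>0 \<sigma> L y1 y2 m
      \<longleftrightarrow> cosh (2 * a * t / L\<^sup>2) \<le> exp (t\<^sup>2 / L\<^sup>2)" for t
    unfolding m_def by (rule variance_reduction_le_midpoint_iff[OF assms(1) a_def])
  have "is_arg_max (variance_reduction \<sigma>0 \<sigma> L y1 y2) (\<lambda>x. x \<in> D) m \<longleftrightarrow> 2 * a\<^sup>2 \<le> L\<^sup>2"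
  proof
    assume max: "is_arg_max (variance_reduction \<sigma>0 \<sigma> L y1 y2) (\<lambda>x. x \<in> D) m"
    show "2 * a\<^sup>2 \<le> L\<^sup>2"
    proof (rule ccontr)
      assume "\<not> 2 * a\<^sup>2 \<le> L\<^sup>2"
      then obtain t where "0 < t" "t \<le> a" "exp (t\<^sup>2 / L\<^sup>2) < cosh (2 * a * t / L\<^sup>2)"
        using exp_square_less_cosh[OF \<open>a > 0\<close> assms(3)] by (auto simp: not_le)
      then show False
        using max mem[of t] le_iff[of t] by (auto simp: is_arg_max_linorder)
    qed
  next
    assume small: "2 * a\<^sup>2 \<le> L\<^sup>2"
    \<comment> \<open>The bound is global on the real line; optimality over \<open>D\<close> then
      follows from \<open>m \<in> D\<close>.\<close>
    have "variance_reduction \<sigma>0 \<sigma> L y1 y2 x \<le> variance_reduction \<sigma>0 \<sigma> L y1 y2 m" for x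
    proof -
      define t where "t = x - m"
      \<comment> \<open>For \<open>u = 2 * a * t / L\<^sup>2\<close>, the assumption
        \<open>small\<close> bounds the exponent \<open>u\<^sup>2 / 2\<close> by
        \<open>t\<^sup>2 / L\<^sup>2\<close>.\<close>
      have "(2 * a * t / L\<^sup>2)\<^sup>2 / 2 = (2 * a\<^sup>2) * (t\<^sup>2 / (L\<^sup>2)\<^sup>2)"
        by (simp add: power_divide power_mult_distrib)
      also have "\<dots> \<le> L\<^sup>2 * (t\<^sup>2 / (L\<^sup>2)\<^sup>2)"
        using small by (intro mult_right_mono) auto
      also have "\<dots> = t\<^sup>2 / L\<^sup>2"
        using assms by (simp add: power2_eq_square)
      finally have "cosh (2 * a * t / L\<^sup>2) \<le> exp (t\<^sup>2 / L\<^sup>2)"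
        using cosh_le_exp_half_square[of "2 * a * t / L\<^sup>2"] by (meson exp_le_cancel_iff order.trans)
      then show ?thesis
        using le_iff[of t] by (simp add: t_def)
    qed
    then show "is_arg_max (variance_reduction \<sigma>0 \<sigma> L y1 y2) (\<lambda>x. x \<in> D) m"
      using mem[of 0] \<open>a > 0\<close> by (simp add: is_arg_max_linorder)
  qed
  then show ?thesis
    by (simp only: m_def norm_eq threshold)
qed

end
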